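(* Let $G(n,n_1,n_2,p_1,p_2)$ be a two-layer stochastic block model network in which every edge has initial weight $1$. Let $\{l,k\}=\{1,2\}$, and let $Q_l$ and $Q'_l$ be the (weighted) modularity of layer $l$ before and after applying ReduceWeight to all communities of the other layer $k$. Then $Q'_l>Q_l$. That is, the modularity of a layer increases if ReduceWeight is applied on all communities of the other layer.
   Context: Two-layer stochastic block model $G(n,n_1,n_2,p_1,p_2)$: $n,n_1,n_2$ are positive integers with $n_1,n_2\ge 3$, and $p_1,p_2\in(0,1]$. For $l=1,2$, layer $l$ is a partition of the $n$ nodes into $n_l$ communities, each of size $s_l=n/n_l$. The two layers are independent of each other, so that each community of layer 1 and each community of layer 2 have $r=n/(n_1n_2)$ nodes in common; $s_1,s_2,r$ are treated as integers and the intersection sizes as exactly $r$. A node pair is internal to layer $l$ if both nodes lie in the same community of layer $l$. Independently for each pair, a pair internal only to layer 1 forms an edge with probability $p_1$, a pair internal only to layer 2 with probability $p_2$, a pair internal to both layers with probability $p_{12}=p_1+p_2-p_1p_2$, and a pair internal to neither layer never forms an edge. Self-loops are allowed and pairs are counted so that a set of $s$ nodes contains $\tfrac12 s^2$ node pairs. All edge quantities are expected values, and in a weighted network they are sums of edge weights. For layer $l$, $e_{ll}$ is the expected total weight of edges internal to one community of layer $l$, $e_{lout}$ is the expected total weight of edges with exactly one endpoint in that community (these are the same for all communities of the layer), and $d_l=2e_{ll}+e_{lout}$. The total edge weight is $e=\tfrac12 n_l d_l$. The modularity of layer $l$ is $Q_l=\sum_{i}\left[\frac{e_{ll}}{e}-\left(\frac{d_l}{2e}\right)^2\right]$,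 the sum being over the $n_l$ communities $i$ of layer $l$. After an operation on the network, modularity is given by the same formula with the (expected) edge weights of the modified network. ReduceWeight on layer $k$ (the weighted counterpart of randomly keeping internal edges with probability $q'_k$): let $\widehat p$ be the (expected) observed edge probability on node pairs internal to communities of layer $k$, that is $\widehat p=e_{kk}/(\tfrac12 s_k^2)$, and let $\widehat q$ be the (expected) observed edge probability on node pairs across communities of layer $k$ (the background noise), that is $\widehat q=e_{kout}/(s_k(n-s_k))$, both computed in the original unit-weight network. The weight of every edge internal to layer $k$ is multiplied by $q'_k=\frac{1-\widehat p}{1-\widehat q}$; all other weights are unchanged. *)

theory Defs
  imports "HOL-Probability.Probability" "HOL-Library.Disjoint_Sets"
begin

text \<open>
  A node pair is an unordered pair \<open>{u, v}\<close>; the self-loop at \<open>u\<close> is the singleton \<open>{u}\<close>.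
  Counting a self-loop pair with multiplicity \<open>1/2\<close> is the convention under which \<open>s\<close> nodes
  contain exactly \<open>s^2/2\<close> pairs, see \<open>sum_pair_count\<close> below.
\<close>

definition node_pairs :: "'a set \<Rightarrow> 'a set set" where
  "node_pairs S = {{u, v} | u v. u \<in> S \<and> v \<in> S}"

definition boundary_pairs :: "'a set \<Rightarrow> 'a set \<Rightarrow> 'a set set" where
  "boundary_pairs V C = {{u, v} | u v. u \<in> C \<and> v \<in> V - C}"

definition pair_count :: "'a set \<Rightarrow> real" where
  "pair_count e = (if is_singleton e then 1 / 2 else 1)"

definition internal :: "'a set set \<Rightarrow> 'a set \<Rightarrow> bool" where
  "internal L e \<longleftrightarrow> (\<exists>C\<in>L. e \<subseteq> C)"

text \<open>
  Layers are indexed by \<open>1\<close> and \<open>2\<close>: \<open>L i\<close> is the partition into communities,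
  \<open>m i\<close> the number of communities and \<open>p i\<close> the edge probability of layer \<open>i\<close>.
  Stating the community and intersection sizes over the reals says in particular that
  \<open>n / m i\<close> and \<open>n / (m 1 * m 2)\<close> are integers.
\<close>

definition two_layer_sbm ::
    "'a set \<Rightarrow> nat \<Rightarrow> (nat \<Rightarrow> nat) \<Rightarrow> (nat \<Rightarrow> 'a set set) \<Rightarrow> (nat \<Rightarrow> real) \<Rightarrow> bool" where
  "two_layer_sbm V n m L p \<longleftrightarrow>
     finite V \<and> card V = n \<and> n > 0 \<and>
     (\<forall>i\<in>{1, 2}. m i \<ge> 3 \<and> 0 < p i \<and> p i \<le> 1 \<and>
        partition_on V (L i) \<and> card (L i) = m i \<and>
        (\<forall>C\<in>L i. real (card C) = real n / real (m i))) \<and>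
     (\<forall>A\<in>L 1. \<forall>B\<in>L 2. real (card (A \<inter> B)) = real n / (real (m 1) * real (m 2)))"

definition edge_prob :: "(nat \<Rightarrow> 'a set set) \<Rightarrow> (nat \<Rightarrow> real) \<Rightarrow> 'a set \<Rightarrow> real" where
  "edge_prob L p e =
     (if internal (L 1) e \<and> internal (L 2) e then p 1 + p 2 - p 1 * p 2
      else if internal (L 1) e then p 1
      else if internal (L 2) e then p 2
      else 0)"

text \<open>The random network, as the random indicator function of its edge set.\<close>

definition sbm_graph ::
    "'a set \<Rightarrow> (nat \<Rightarrow> 'a set set) \<Rightarrow> (nat \<Rightarrow> real) \<Rightarrow> ('a set \<Rightarrow> bool) pmf" where
  "sbm_graph V L p = Pi_pmf (node_pairs V) False (\<lambda>e. bernoulli_pmf (edge_prob L p e))"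

definition expected_weight ::
    "('a set \<Rightarrow> bool) pmf \<Rightarrow> ('a set \<Rightarrow> real) \<Rightarrow> 'a set set \<Rightarrow> real" where
  "expected_weight G w E =
     measure_pmf.expectation G (\<lambda>X. \<Sum>e\<in>E. if X e then pair_count e * w e else 0)"

definition e_in :: "('a set \<Rightarrow> bool) pmf \<Rightarrow> ('a set \<Rightarrow> real) \<Rightarrow> 'a set \<Rightarrow> real" where
  "e_in G w C = expected_weight G w (node_pairs C)"

definition e_out ::
    "'a set \<Rightarrow> ('a set \<Rightarrow> bool) pmf \<Rightarrow> ('a set \<Rightarrow> real) \<Rightarrow> 'a set \<Rightarrow> real" where
  "e_out V G w C = expected_weight G w (boundary_pairs V C)"

definition comm_degree ::
    "'a set \<Rightarrow> ('a set \<Rightarrow> bool) pmf \<Rightarrow> ('a set \<Rightarrow> real) \<Rightarrow> 'a set \<Rightarrow> real" where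
  "comm_degree V G w C = 2 * e_in G w C + e_out V G w C"

text \<open>
  The total edge weight is half the sum of the community degrees of any layer
  (\<open>total_weight_eq\<close> below), hence half the number of communities times the common
  community degree if the latter is the same for all communities.
\<close>

definition total_weight ::
    "'a set \<Rightarrow> ('a set \<Rightarrow> bool) pmf \<Rightarrow> ('a set \<Rightarrow> real) \<Rightarrow> real" where
  "total_weight V G w = expected_weight G w (node_pairs V)"

definition modularity ::
    "'a set \<Rightarrow> ('a set \<Rightarrow> bool) pmf \<Rightarrow> ('a set \<Rightarrow> real) \<Rightarrow> 'a set set \<Rightarrow> real" where
  "modularity V G w Q =
     (\<Sum>C\<in>Q. e_in G w C / total_weight V G w
             - (comm_degree V G w C / (2 * total_weight V G w))\<^sup>2)"

abbreviation unit_weight :: "'a set \<Rightarrow> real" where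
  "unit_weight \<equiv> (\<lambda>_. 1)"

definition p_hat :: "('a set \<Rightarrow> bool) pmf \<Rightarrow> 'a set \<Rightarrow> real" where
  "p_hat G C = e_in G unit_weight C / (1 / 2 * (real (card C))\<^sup>2)"

definition q_hat :: "'a set \<Rightarrow> ('a set \<Rightarrow> bool) pmf \<Rightarrow> 'a set \<Rightarrow> real" where
  "q_hat V G C =
     e_out V G unit_weight C / (real (card C) * (real (card V) - real (card C)))"

definition reduce_factor :: "'a set \<Rightarrow> ('a set \<Rightarrow> bool) pmf \<Rightarrow> 'a set \<Rightarrow> real" where
  "reduce_factor V G C = (1 - p_hat G C) / (1 - q_hat V G C)"

text \<open>
  ReduceWeight applied to all communities of the layer \<open>Q\<close>, starting from weights \<open>w\<close>.
  A pair is contained in at most one community, so the product has one factor for pairs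
  internal to \<open>Q\<close> and is empty for all others. The observed probabilities are those of the
  unit-weight network, whatever \<open>w\<close> is. They are formed for each community separately; in the
  block model they are the same for all communities of a layer.
\<close>

definition reduce_weight ::
    "'a set \<Rightarrow> ('a set \<Rightarrow> bool) pmf \<Rightarrow> 'a set set \<Rightarrow> ('a set \<Rightarrow> real) \<Rightarrow> 'a set \<Rightarrow> real" where
  "reduce_weight V G Q w e = w e * (\<Prod>C\<in>{C\<in>Q. e \<subseteq> C}. reduce_factor V G C)"


lemma node_pairs_insert:
  "node_pairs (insert x S) = insert {x} ((\<lambda>v. {x, v}) ` S \<union> node_pairs S)"
  unfolding node_pairs_def by (auto simp: insert_commute)

lemma finite_node_pairs: "finite S \<Longrightarrow> finite (node_pairs S)"
  by (rule finite_subset[of _ "Pow S"]) (auto simp: node_pairs_def)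

lemma sum_node_pairs:
  fixes g :: "'a set \<Rightarrow> real"
  assumes "finite S"
  shows "(\<Sum>e\<in>node_pairs S. pair_count e * g e) = 1 / 2 * (\<Sum>u\<in>S. \<Sum>v\<in>S. g {u, v})"
  using assms
proof (induction S)
  case empty
  then show ?case by (simp add: node_pairs_def)
next
  case (insert x S)
  let ?h = "\<lambda>e. pair_count e * g e"
  have inj: "inj_on (\<lambda>v. {x, v}) S"
    by (auto simp: inj_on_def doubleton_eq_iff)
  have out: "x \<notin> e" if "e \<in> node_pairs S" for e
    using that insert.hyps by (auto simp: node_pairs_def)
  have pc: "pair_count {x, v} = 1" if "v \<in> S" for v
    using that insert.hyps by (auto simp: pair_count_def is_singleton_def doubleton_eq_iff)
  have disj: "(\<lambda>v. {x, v}) ` S \<inter> node_pairs S = {}"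
    using out by fastforce
  have notin: "{x} \<notin> (\<lambda>v. {x, v}) ` S \<union> node_pairs S"
    using out insert.hyps by fastforce
  have "(\<Sum>e\<in>node_pairs (insert x S). ?h e)
        = ?h {x} + (\<Sum>e\<in>(\<lambda>v. {x, v}) ` S \<union> node_pairs S. ?h e)"
    unfolding node_pairs_insert
    using notin insert.hyps finite_node_pairs[OF insert.hyps(1)] by simp
  also have "(\<Sum>e\<in>(\<lambda>v. {x, v}) ` S \<union> node_pairs S. ?h e)
        = (\<Sum>e\<in>(\<lambda>v. {x, v}) ` S. ?h e) + (\<Sum>e\<in>node_pairs S. ?h e)"
    using disj insert.hyps finite_node_pairs[OF insert.hyps(1)]
    by (intro sum.union_disjoint) auto
  also have "(\<Sum>e\<in>(\<lambda>v. {x, v}) ` S. ?h e) = (\<Sum>v\<in>S. g {x, v})"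
    using pc by (simp add: sum.reindex[OF inj])
  also have "?h {x} = 1 / 2 * g {x}"
    by (simp add: pair_count_def)
  finally show ?case
    using insert by (simp add: sum.distrib insert_commute algebra_simps)
qed

lemma sum_pair_count:
  assumes "finite S"
  shows "(\<Sum>e\<in>node_pairs S. pair_count e) = 1 / 2 * (real (card S))\<^sup>2"
  using sum_node_pairs[OF assms, of "\<lambda>_. 1"] by (simp add: power2_eq_square)

lemma sum_boundary_pairs:
  fixes g :: "'a set \<Rightarrow> real"
  assumes "C \<subseteq> V"
  shows "(\<Sum>e\<in>boundary_pairs V C. pair_count e * g e) = (\<Sum>u\<in>C. \<Sum>v\<in>V - C. g {u, v})"
proof -
  let ?f = "\<lambda>(u, v). {u, v}"
  have inj: "inj_on ?f (C \<times> (V - C))"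
    by (auto simp: inj_on_def doubleton_eq_iff)
  have im: "boundary_pairs V C = ?f ` (C \<times> (V - C))"
    by (auto simp: boundary_pairs_def)
  have pc: "pair_count {u, v} = 1" if "u \<in> C" "v \<in> V - C" for u v
    using that by (auto simp: pair_count_def is_singleton_def doubleton_eq_iff)
  have "(\<Sum>e\<in>boundary_pairs V C. pair_count e * g e) = (\<Sum>(u, v)\<in>C \<times> (V - C). g {u, v})"
    unfolding im sum.reindex[OF inj] by (rule sum.cong) (auto simp: pc)
  then show ?thesis
    by (simp add: sum.cartesian_product)
qed

lemma expected_weight_eq:
  "expected_weight G w E = (\<Sum>e\<in>E. pair_count e * (w e * measure_pmf.prob G {X. X e}))"
proof -
  have "measure_pmf.expectation G (\<lambda>X. if X e then c else 0)
        = c * measure_pmf.prob G {X. X e}" for e and c :: real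
  proof -
    have "(\<lambda>X. if X e then c else 0) = (\<lambda>X. c * indicator {X. X e} X)"
      by (auto simp: indicator_def)
    then show ?thesis by simp
  qed
  moreover have "integrable (measure_pmf G) (\<lambda>X. if X e then c else 0)" for e and c :: real
    by (rule measure_pmf.integrable_const_bound[where B = "\<bar>c\<bar>"]) auto
  ultimately show ?thesis
    unfolding expected_weight_def by (subst Bochner_Integration.integral_sum) (auto simp: mult.assoc)
qed

lemma total_weight_eq:
  assumes "finite V" and "partition_on V Q"
  shows "total_weight V G w = 1 / 2 * (\<Sum>C\<in>Q. comm_degree V G w C)"
proof -
  define g where "g = (\<lambda>e. w e * measure_pmf.prob G {X. X e})"
  have sub: "C \<subseteq> V" if "C \<in> Q" for C
    using that assms(2) by (auto simp: partition_on_def)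
  have fin: "finite C" if "C \<in> Q" for C
    using sub[OF that] assms(1) by (rule finite_subset)
  have "comm_degree V G w C = (\<Sum>u\<in>C. \<Sum>v\<in>V. g {u, v})" if "C \<in> Q" for C
  proof -
    have "comm_degree V G w C = (\<Sum>u\<in>C. (\<Sum>v\<in>C. g {u, v}) + (\<Sum>v\<in>V - C. g {u, v}))"
      unfolding comm_degree_def e_in_def e_out_def expected_weight_eq g_def[symmetric]
      using sum_node_pairs[OF fin[OF that], of g] sum_boundary_pairs[OF sub[OF that], of g]
      by (simp add: g_def sum.distrib)
    moreover have "(\<Sum>v\<in>C. h v) + (\<Sum>v\<in>V - C. h v) = (\<Sum>v\<in>V. h v)" for h :: "'a \<Rightarrow> real"
      using sum.subset_diff[OF sub[OF that] assms(1), of h] by simp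
    ultimately show ?thesis by simp
  qed
  then have "(\<Sum>C\<in>Q. comm_degree V G w C) = (\<Sum>C\<in>Q. \<Sum>u\<in>C. \<Sum>v\<in>V. g {u, v})"
    by simp
  also have "\<dots> = (\<Sum>u\<in>\<Union>Q. \<Sum>v\<in>V. g {u, v})"
    using assms fin by (subst sum.Union_disjoint) (auto simp: partition_on_def disjoint_def)
  also have "\<Union>Q = V"
    using assms(2) by (simp add: partition_on_def)
  finally show ?thesis
    unfolding total_weight_def expected_weight_eq
    using sum_node_pairs[OF assms(1), of g] by (simp add: g_def)
qed

end

theory Submission imports Defs
begin

text \<open>
  Let \<open>s\<close> and \<open>t\<close> be the community sizes of the layers \<open>l\<close> and \<open>k\<close>, let \<open>r\<close> be the intersection
  size, and give the pairs internal to layer \<open>k\<close> the weight \<open>w\<close>. Every node then has expected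
  degree \<open>I + O\<close> with \<open>I = r p\<^sub>1\<^sub>2 w + (s - r) p\<^sub>l\<close> inside and \<open>O = (t - r) p\<^sub>k w\<close> outside its
  community of layer \<open>l\<close>, and the modularity of layer \<open>l\<close> equals \<open>I / (I + O) - 1 / m\<^sub>l\<close>. This is
  strictly decreasing in \<open>w \<ge> 0\<close>. The factor of ReduceWeight lies in \<open>[0, 1)\<close>, because the observed
  probabilities are \<open>q = p\<^sub>l / m\<^sub>l < 1\<close> and \<open>p = p\<^sub>1\<^sub>2 / m\<^sub>l + (1 - 1 / m\<^sub>l) p\<^sub>k \<le> 1\<close>, with \<open>q < p\<close>.
\<close>

text \<open>The expected weight of a pair in the block model depends only on which layers it is
  internal to, and ReduceWeight on one layer preserves this shape. One function thus serves the
  network before and after the operation.\<close>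

definition block_value :: "'a set set \<Rightarrow> 'a set set \<Rightarrow> real \<Rightarrow> real \<Rightarrow> real \<Rightarrow> 'a set \<Rightarrow> real" where
  "block_value P Q a b c e =
     (if internal P e \<and> internal Q e then a
      else if internal P e then b
      else if internal Q e then c
      else 0)"

lemma block_value_swap: "block_value P Q a b c = block_value Q P a c b"
  by (auto simp: block_value_def fun_eq_iff)

lemma partition_on_block_unique:
  assumes "partition_on V P" "A \<in> P" "B \<in> P" "x \<in> A" "x \<in> B"
  shows "A = B"
  using assms by (auto simp: partition_on_def disjoint_def)

lemma internal_pair_iff:
  assumes "partition_on V P" "A \<in> P" "u \<in> A"
  shows "internal P {u, v} \<longleftrightarrow> v \<in> A"
  using partition_on_block_unique[OF assms(1,2)] assms unfolding internal_def by blast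

lemma edge_prob_eq_block_value:
  assumes "{l, k} = {1, 2}"
  shows "edge_prob L p = block_value (L l) (L k) (p l + p k - p l * p k) (p l) (p k)"
  using assms by (auto simp: edge_prob_def block_value_def fun_eq_iff doubleton_eq_iff)

text \<open>This is a marginal of a product measure. The bounds matter because
  \<open>bernoulli_pmf\<close> clamps its parameter to the unit interval.\<close>

lemma prob_sbm_graph:
  assumes "finite V" "e \<in> node_pairs V" "0 \<le> edge_prob L p e" "edge_prob L p e \<le> 1"
  shows "measure_pmf.prob (sbm_graph V L p) {X. X e} = edge_prob L p e"
proof -
  have "map_pmf (\<lambda>X. X e) (sbm_graph V L p) = bernoulli_pmf (edge_prob L p e)"
    unfolding sbm_graph_def using assms(2)
    by (subst Pi_pmf_component) (auto simp: finite_node_pairs[OF assms(1)])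
  moreover have "measure_pmf.prob (sbm_graph V L p) {X. X e}
      = measure_pmf.prob (map_pmf (\<lambda>X. X e) (sbm_graph V L p)) {True}"
    by (simp add: vimage_def)
  ultimately show ?thesis
    using assms(3,4) by (simp add: measure_pmf_single)
qed

lemma reduce_weight_eq:
  assumes "partition_on V Q" "e \<in> node_pairs V"
    and "\<And>C. C \<in> Q \<Longrightarrow> reduce_factor V G C = c"
  shows "reduce_weight V G Q w e = w e * (if internal Q e then c else 1)"
proof (cases "internal Q e")
  case True
  then obtain C where C: "C \<in> Q" "e \<subseteq> C" by (auto simp: internal_def)
  \<comment> \<open>An empty set would be contained in every block; a nonempty one lies in at most
    one, so the product has a single factor.\<close>
  have "e \<noteq> {}" using assms(2) by (auto simp: node_pairs_def)
  then have "{D \<in> Q. e \<subseteq> D} = {C}"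
    using C partition_on_block_unique[OF assms(1)] by blast
  then show ?thesis using True C assms(3) by (simp add: reduce_weight_def)
next
  case False
  then have "{D \<in> Q. e \<subseteq> D} = {}" by (auto simp: internal_def)
  then show ?thesis using False by (simp only: reduce_weight_def prod.empty if_False)
qed

text \<open>Free of layer indices, so that it can be used in both orders: one for the modularity of
  layer \<open>l\<close>, the other for the observed probabilities of layer
  \<open>k\<close>.\<close>

locale crossing_partitions =
  fixes V :: "'a set" and P Q :: "'a set set" and s t r :: real
  assumes finite_V: "finite V"
    and partition_P: "partition_on V P" and partition_Q: "partition_on V Q"
    and card_P: "A \<in> P \<Longrightarrow> real (card A) = s"
    and card_Q: "B \<in> Q \<Longrightarrow> real (card B) = t"
    and card_Int: "A \<in> P \<Longrightarrow> B \<in> Q \<Longrightarrow> real (card (A \<inter> B)) = r"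
begin

lemma crossing_partitions_swap: "crossing_partitions V Q P t s r"
proof
  show "real (card (B \<inter> A)) = r" if "B \<in> Q" "A \<in> P" for A B
    using card_Int[OF that(2,1)] by (simp add: Int_commute)
qed (use finite_V partition_P partition_Q card_P card_Q in auto)

lemma block_subset: "A \<in> P \<Longrightarrow> A \<subseteq> V"
  using partition_P by (auto simp: partition_on_def)

text \<open>The node \<open>u\<close> lies in exactly one block \<open>B\<close> of
  \<open>Q\<close>. Hence \<open>v\<close> contributes \<open>a\<close> on
  \<open>A \<inter> B\<close>, \<open>b\<close> on \<open>A - B\<close>, \<open>c\<close> on
  \<open>B - A\<close>, and nothing elsewhere.\<close>

lemma sum_block_value:
  assumes "A \<in> P" "u \<in> A"
  shows "(\<Sum>v\<in>A. block_value P Q a b c {u, v}) = r * a + (s - r) * b"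
    and "(\<Sum>v\<in>V - A. block_value P Q a b c {u, v}) = (t - r) * c"
proof -
  from assms obtain B where B: "B \<in> Q" "u \<in> B"
    using block_subset partition_Q by (auto simp: partition_on_def)
  have BV: "B \<subseteq> V" using B partition_Q by (auto simp: partition_on_def)
  have fin: "finite A" "finite B"
    using block_subset[OF assms(1)] BV finite_V by (auto intro: finite_subset)
  have val: "block_value P Q a b c {u, v} =
      (if v \<in> A \<and> v \<in> B then a else if v \<in> A then b else if v \<in> B then c else 0)" for v
    unfolding block_value_def
    by (simp only: internal_pair_iff[OF partition_P assms] internal_pair_iff[OF partition_Q B])
  have "real (card (A - B)) = s - r" "real (card (B - A)) = t - r"
    using card_P[OF assms(1)] card_Q[OF B(1)] card_Int[OF assms(1) B(1)] fin
      card_Diff_subset_Int[of A B] card_Diff_subset_Int[of B A]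
      card_mono[of A "A \<inter> B"] card_mono[of B "A \<inter> B"]
    by (auto simp: Int_commute of_nat_diff)
  note card = this card_Int[OF assms(1) B(1)]
  have "(\<Sum>v\<in>A. block_value P Q a b c {u, v}) = (\<Sum>v\<in>A. if v \<in> B then a else b)"
    by (rule sum.cong) (auto simp: val)
  also have "\<dots> = r * a + (s - r) * b"
    using fin card by (simp add: sum.If_cases Diff_eq[symmetric])
  finally show "(\<Sum>v\<in>A. block_value P Q a b c {u, v}) = r * a + (s - r) * b" .
  have "(\<Sum>v\<in>V - A. block_value P Q a b c {u, v}) = (\<Sum>v\<in>V - A. if v \<in> B then c else 0)"
    by (rule sum.cong) (auto simp: val)
  also have "\<dots> = (\<Sum>v\<in>B - A. c)"
    using BV finite_V by (intro sum.mono_neutral_cong_right) auto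
  also have "\<dots> = (t - r) * c" using card by simp
  finally show "(\<Sum>v\<in>V - A. block_value P Q a b c {u, v}) = (t - r) * c" .
qed

lemma e_in_out_block_value:
  assumes A: "A \<in> P"
    and g: "\<And>e. e \<in> node_pairs V \<Longrightarrow>
      w e * measure_pmf.prob G {X. X e} = block_value P Q a b c e"
  shows "e_in G w A = 1 / 2 * s * (r * a + (s - r) * b)"
    and "e_out V G w A = s * ((t - r) * c)"
proof -
  note AV = block_subset[OF A]
  have sub: "node_pairs A \<subseteq> node_pairs V" "boundary_pairs V A \<subseteq> node_pairs V"
    using AV by (auto simp: node_pairs_def boundary_pairs_def)
  have fin: "finite A" using AV finite_V by (rule finite_subset)
  have "e_in G w A = (\<Sum>e\<in>node_pairs A. pair_count e * block_value P Q a b c e)"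
    unfolding e_in_def expected_weight_eq
    by (rule sum.cong) (use sub(1) g in auto)
  then show "e_in G w A = 1 / 2 * s * (r * a + (s - r) * b)"
    using sum_block_value(1)[OF A] card_P[OF A] by (simp add: sum_node_pairs[OF fin])
  have "e_out V G w A = (\<Sum>e\<in>boundary_pairs V A. pair_count e * block_value P Q a b c e)"
    unfolding e_out_def expected_weight_eq
    by (rule sum.cong) (use sub(2) g in auto)
  then show "e_out V G w A = s * ((t - r) * c)"
    using sum_block_value(2)[OF A] card_P[OF A] by (simp add: sum_boundary_pairs[OF AV])
qed

text \<open>With inner node degree \<open>I\<close> and full node degree \<open>D\<close>, the total
  weight is \<open>card P * s * D / 2\<close>, so each of the \<open>card P\<close> communities
  contributes \<open>I / (card P * D) - 1 / (card P)^2\<close>.\<close>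

lemma modularity_block_value:
  assumes g: "\<And>e. e \<in> node_pairs V \<Longrightarrow>
      w e * measure_pmf.prob G {X. X e} = block_value P Q a b c e"
    and "card P > 0" "s > 0"
    and pos: "r * a + (s - r) * b + (t - r) * c > 0"
  shows "modularity V G w P =
    (r * a + (s - r) * b) / (r * a + (s - r) * b + (t - r) * c) - 1 / real (card P)"
proof -
  define I where "I = r * a + (s - r) * b"
  define D where "D = I + (t - r) * c"
  have D: "D > 0" using pos by (simp add: D_def I_def)
  have e_in: "e_in G w A = 1 / 2 * s * I" if "A \<in> P" for A
    using e_in_out_block_value(1)[OF that g] by (simp add: I_def)
  have deg: "comm_degree V G w A = s * D" if "A \<in> P" for A
    using e_in_out_block_value[OF that g]
    by (simp add: comm_degree_def D_def I_def) (simp add: algebra_simps)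
  have total: "total_weight V G w = 1 / 2 * real (card P) * s * D"
    using deg by (simp add: total_weight_eq[OF finite_V partition_P])
  show ?thesis
    unfolding modularity_def I_def[symmetric] D_def[symmetric]
    using assms(2,3) D by (simp add: e_in deg total divide_simps power2_eq_square)
qed

end

text \<open>Here \<open>u\<close> and \<open>x / M\<close> are the observed probabilities inside and
  across communities of layer \<open>k\<close>. The upper bound on \<open>u\<close> rests on
  \<open>1 - (x + y - x * y) = (1 - x) * (1 - y)\<close>, the strict one on
  \<open>M * u - x = y * (1 - x) + (M - 1) * y\<close>.\<close>

lemma reduce_factor_bounds:
  fixes x y M :: real
  assumes "0 < x" "x \<le> 1" "0 < y" "y \<le> 1" "M > 1"
  defines "u \<equiv> ((x + y - x * y) + (M - 1) * y) / M"
  shows "0 \<le> (1 - u) / (1 - x / M)" "(1 - u) / (1 - x / M) < 1"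
proof -
  have "0 \<le> (1 - x) * (1 - y)" "(M - 1) * y \<le> M - 1" 
    using assms by auto
  then have "u \<le> 1" using assms by (simp add: u_def divide_simps algebra_simps)
  moreover have "x / M < 1" using assms by (simp add: divide_simps)
  moreover have "x / M < u"
  proof -
    have "0 \<le> y * (1 - x)" "0 < (M - 1) * y" using assms by auto
    then show ?thesis using assms by (simp add: u_def divide_simps algebra_simps)
  qed
  ultimately show "0 \<le> (1 - u) / (1 - x / M)" "(1 - u) / (1 - x / M) < 1"
    by auto
qed

text \<open>After cross-multiplication all terms cancel except
  \<open>w * b * c < b * c\<close>.\<close>

lemma scaled_ratio_mono:
  fixes a b c w :: real
  assumes "a \<ge> 0" "b > 0" "c > 0" "0 \<le> w" "w < 1"
  shows "(a + b) / (a + b + c) < (w * a + b) / (w * a + b + w * c)"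
proof -
  have "w * (b * c) < b * c" using assms by simp
  moreover have "0 < w * a + b + w * c" using assms by (simp add: add_nonneg_pos add_pos_nonneg)
  ultimately show ?thesis using assms
    by (simp add: divide_simps add_pos_pos add_nonneg_pos) (simp add: algebra_simps)
qed

theorem theorem4:
  fixes V :: "'a set" and n :: nat and m :: "nat \<Rightarrow> nat"
    and L :: "nat \<Rightarrow> 'a set set" and p :: "nat \<Rightarrow> real" and l k :: nat
  assumes "two_layer_sbm V n m L p"
    and "{l, k} = {1, 2}"
  shows "modularity V (sbm_graph V L p)
           (reduce_weight V (sbm_graph V L p) (L k) unit_weight) (L l)
         > modularity V (sbm_graph V L p) unit_weight (L l)"
proof -
  define G where "G = sbm_graph V L p"
  define M N where "M = real (m l)" and "N = real (m k)"
  define s t r where "s = real n / M" and "t = real n / N" and "r = real n / (M * N)"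
  define p12 where "p12 = p l + p k - p l * p k"
  note sbm = assms(1)[unfolded two_layer_sbm_def]
  have lk: "l \<in> {1, 2}" "k \<in> {1, 2}" using assms(2) by auto
  have V: "finite V" "card V = n" "n > 0" using sbm by auto
  have l: "m l \<ge> 3" "0 < p l" "p l \<le> 1" "partition_on V (L l)" "card (L l) = m l"
    "\<And>C. C \<in> L l \<Longrightarrow> real (card C) = s"
    using sbm lk(1) by (auto simp: s_def M_def)
  have k: "m k \<ge> 3" "0 < p k" "p k \<le> 1" "partition_on V (L k)" "card (L k) = m k"
    "\<And>C. C \<in> L k \<Longrightarrow> real (card C) = t"
    using sbm lk(2) by (auto simp: t_def N_def)
  have int: "real (card (A \<inter> B)) = r" if "A \<in> L l" "B \<in> L k" for A B
    using sbm assms(2) that by (auto simp: r_def M_def N_def doubleton_eq_iff Int_commute mult.commute)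
  interpret lk: crossing_partitions V "L l" "L k" s t r
    using V l k int by unfold_locales auto
  interpret kl: crossing_partitions V "L k" "L l" t s r
    by (rule lk.crossing_partitions_swap)
  have MN: "M \<ge> 3" "N \<ge> 3" using l k by (auto simp: M_def N_def)
  have sizes: "r > 0" "s - r > 0" "t - r > 0" "s > 0" "t > 0"
    using MN V(3) by (auto simp: s_def t_def r_def divide_simps)
  \<comment> \<open>The two products equal \<open>p12 - p k\<close> and
    \<open>1 - p12\<close>.\<close>
  have "0 \<le> p l * (1 - p k)" "0 \<le> (1 - p l) * (1 - p k)" using l k by auto
  then have p12: "0 < p12" "p12 \<le> 1"
    using l(2) k(2) unfolding p12_def right_diff_distrib left_diff_distrib by linarith+

  have prob: "measure_pmf.prob G {X. X e} = block_value (L l) (L k) p12 (p l) (p k) e"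
    if "e \<in> node_pairs V" for e
  proof -
    have eq: "edge_prob L p e = block_value (L l) (L k) p12 (p l) (p k) e"
      by (simp add: p12_def edge_prob_eq_block_value[OF assms(2)])
    then have "0 \<le> edge_prob L p e" "edge_prob L p e \<le> 1"
      using l k p12 by (auto simp: block_value_def)
    with V that eq show ?thesis by (simp add: G_def prob_sbm_graph)
  qed

  \<comment> \<open>Since \<open>r = t / M\<close>, a fraction \<open>1 / M\<close> of the pairs
    inside a community of layer \<open>k\<close> is internal to layer \<open>l\<close> too; by
    \<open>s - r = (n - t) / M\<close>, the same fraction of its boundary pairs is internal to layer
    \<open>l\<close>.\<close>
  define w where "w = (1 - (p12 + (M - 1) * p k) / M) / (1 - p l / M)"
  have factor: "reduce_factor V G C = w" if "C \<in> L k" for C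
  proof -
    have C: "real (card C) = t" using k that by blast
    have n: "real n = t * N" "s = t * N / M" "r = t / M"
      using MN by (auto simp: t_def s_def r_def)
    have "unit_weight e * measure_pmf.prob G {X. X e}
        = block_value (L k) (L l) p12 (p k) (p l) e" if "e \<in> node_pairs V" for e
      using prob[OF that] block_value_swap by (metis mult_1)
    then have e: "e_in G unit_weight C = 1 / 2 * t * (r * p12 + (t - r) * p k)"
      "e_out V G unit_weight C = t * ((s - r) * p l)"
      by (intro kl.e_in_out_block_value[OF that]; blast)+
    have "p_hat G C = (p12 + (M - 1) * p k) / M"
      using sizes MN unfolding p_hat_def e C n
      by (simp add: divide_simps power2_eq_square) (simp add: algebra_simps)
    \<comment> \<open>This exposes the factor \<open>n - t\<close>, which cancels in
      \<open>q_hat\<close>.\<close>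
    moreover have "t * N - t > 0" "t * N / M - t / M = (t * N - t) / M"
      using sizes MN by (auto simp: diff_divide_distrib)
    then have "q_hat V G C = p l / M"
      using sizes MN unfolding q_hat_def e C V(2) n
      by (simp add: divide_simps)
    ultimately show ?thesis by (simp add: reduce_factor_def w_def)
  qed
  have w: "0 \<le> w" "w < 1"
    using reduce_factor_bounds[of "p l" "p k" M] l k MN by (auto simp: w_def p12_def)

  have unit: "unit_weight e * measure_pmf.prob G {X. X e}
      = block_value (L l) (L k) p12 (p l) (p k) e" if "e \<in> node_pairs V" for e
    using prob[OF that] by simp
  \<comment> \<open>Exactly the two values of pairs internal to layer \<open>k\<close> are scaled by
    \<open>w\<close>.\<close>
  have red: "reduce_weight V G (L k) unit_weight e * measure_pmf.prob G {X. X e}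
      = block_value (L l) (L k) (w * p12) (p l) (w * p k) e" if "e \<in> node_pairs V" for e
    using prob[OF that] reduce_weight_eq[OF k(4) that factor, of unit_weight]
    by (simp add: block_value_def)
  have card: "card (L l) > 0" using l by simp
  have pos: "r * p12 > 0" "(s - r) * p l > 0" "(t - r) * p k > 0"
    using sizes p12 l k by auto
  have mod_unit: "modularity V G unit_weight (L l) =
      (r * p12 + (s - r) * p l) / (r * p12 + (s - r) * p l + (t - r) * p k) - 1 / real (card (L l))"
    by (rule lk.modularity_block_value[OF unit card]) (use sizes pos in auto)
  \<comment> \<open>The factor \<open>w\<close> vanishes when \<open>p k = 1\<close>; the pairs
    internal only to layer \<open>l\<close> then keep the degree positive.\<close>
  have "w * (r * p12) \<ge> 0" "w * ((t - r) * p k) \<ge> 0"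
    using w pos by (auto intro!: mult_nonneg_nonneg)
  then have "0 < r * (w * p12) + (s - r) * p l + (t - r) * (w * p k)"
    using pos by (simp add: mult.left_commute)
  from lk.modularity_block_value[OF red card sizes(4) this]
  have mod_red: "modularity V G (reduce_weight V G (L k) unit_weight) (L l) =
      (w * (r * p12) + (s - r) * p l) / (w * (r * p12) + (s - r) * p l + w * ((t - r) * p k))
      - 1 / real (card (L l))"
    by (simp add: mult.left_commute)
  show ?thesis
    using scaled_ratio_mono[OF less_imp_le[OF pos(1)] pos(2,3) w]
    unfolding G_def[symmetric] mod_unit mod_red by simp
qed

end
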